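(* Let $X\subset\mathbb{RP}^3$ be the open set of scaling classes of real cubics with negative discriminant, let $\mathcal{S}$ be the intersection of $X$ with a projective plane $P\subset\mathbb{RP}^3$, and let $\mathcal{R}|_{\mathcal{S}}\colon\mathcal{S}\to\mathbb{C}$ be the projection onto the complex root (the root with positive imaginary part). (i) $\mathcal{R}|_{\mathcal{S}}$ is singular along at most one projective line $L\subset\mathcal{S}$; that is, the set of points of $\mathcal{S}$ at which the differential of $\mathcal{R}|_{\mathcal{S}}$ is not injective is either empty or a single projective line $L$, on which $\mathcal{R}$ is constant. (ii) If $P$ has a rational normal vector (so $\mathcal{S}$ gives a planar starscape), this line $L$, if it exists, corresponds to rational polynomials with a linear factor over $\mathbb{Q}$, i.e. it is the fiber of $\mathcal{R}$ over a quadratic point $z$ of the complex plane (a non-real root of an irreducible quadratic in $\mathbb{Q}[x]$). (iii) Every such quadratic point $z$ gives a singularity of $\mathcal{R}|_{\mathcal{S}}$ for some $\mathcal{S}$ obtained from a plane $P$ with rational normal vector.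
   Context: Cubics are binary cubic forms $ax^3+bx^2y+cxy^2+dy^3$ with real coefficients, up to scaling, identified with $[a:b:c:d]\in\mathbb{RP}^3$; negative discriminant means one root in $\mathbb{RP}^1$ and a pair of non-real complex conjugate roots. A projective plane with rational normal vector is $\{[a:b:c:d]\mid n_1a+n_2b+n_3c+n_4d=0\}$ with $(n_1,n_2,n_3,n_4)\in\mathbb{Q}^4\setminus\{0\}$. The fiber of $\mathcal{R}$ over $z$ is the projective line of all real cubics $(sx+ty)(x-zy)(x-\overline zy)$, $[s:t]\in\mathbb{RP}^1$. *)

theory Defs
  imports "HOL-Analysis.Analysis" "HOL-Computational_Algebra.Computational_Algebra"
begin

text \<open>
  A vector \<open>f :: real^4\<close> is the binary cubic form with coefficients
  \<open>f$1, f$2, f$3, f$4\<close> of \<open>x^3, x^2 y, x y^2, y^3\<close>; \<open>RP^3\<close> is the type of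
  nonzero vectors up to scaling.
\<close>

definition proj_rel :: "real^4 \<Rightarrow> real^4 \<Rightarrow> bool" where
  "proj_rel f g \<longleftrightarrow> f \<noteq> 0 \<and> g \<noteq> 0 \<and> (\<exists>c. c \<noteq> 0 \<and> g = c *\<^sub>R f)"

lemma proj_rel_part_equivp: "part_equivp proj_rel"
proof (rule part_equivpI)
  show "\<exists>f. proj_rel f f"
    by (rule exI[of _ "axis 1 1"]) (auto simp: proj_rel_def intro: exI[of _ 1])
  show "symp proj_rel"
  proof (rule sympI)
    fix f g assume "proj_rel f g"
    then obtain c where c: "f \<noteq> 0" "g \<noteq> 0" "c \<noteq> 0" "g = c *\<^sub>R f"
      by (auto simp: proj_rel_def)
    then have "f = inverse c *\<^sub>R g" by simp
    with c show "proj_rel g f"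
      unfolding proj_rel_def by (metis nonzero_imp_inverse_nonzero)
  qed
  show "transp proj_rel"
  proof (rule transpI)
    fix f g h assume "proj_rel f g" "proj_rel g h"
    then obtain c d where "f \<noteq> 0" "h \<noteq> 0" "c \<noteq> 0" "d \<noteq> 0" "h = (d * c) *\<^sub>R f"
      by (auto simp: proj_rel_def)
    then show "proj_rel f h"
      unfolding proj_rel_def by (metis mult_eq_0_iff)
  qed
qed

quotient_type rp3 = "real^4" / partial: proj_rel
  by (rule proj_rel_part_equivp)

text \<open>The class \<open>[f]\<close>; unspecified for \<open>f = 0\<close>.\<close>

definition proj_class :: "real^4 \<Rightarrow> rp3" where
  "proj_class f = abs_rp3 f"

definition proj_line :: "rp3 set \<Rightarrow> bool" where
  "proj_line L \<longleftrightarrow> (\<exists>W. subspace W \<and> dim W = 2 \<and> L = {proj_class f |f. f \<in> W \<and> f \<noteq> 0})"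

definition plane_normal :: "real^4 \<Rightarrow> rp3 set" where
  "plane_normal n = {proj_class f |f. f \<noteq> 0 \<and> n \<bullet> f = 0}"

definition proj_plane :: "rp3 set \<Rightarrow> bool" where
  "proj_plane P \<longleftrightarrow> (\<exists>n. n \<noteq> 0 \<and> P = plane_normal n)"

definition rational_vec :: "real^4 \<Rightarrow> bool" where
  "rational_vec f \<longleftrightarrow> (\<forall>i. f $ i \<in> \<rat>)"

definition rational_plane :: "rp3 set \<Rightarrow> bool" where
  "rational_plane P \<longleftrightarrow> (\<exists>n. n \<noteq> 0 \<and> rational_vec n \<and> P = plane_normal n)"

definition cubic_eval :: "real^4 \<Rightarrow> complex \<Rightarrow> complex \<Rightarrow> complex" where
  "cubic_eval f x y = of_real (f$1) * x^3 + of_real (f$2) * x^2 * y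
     + of_real (f$3) * x * y^2 + of_real (f$4) * y^3"

definition cubic_disc :: "real^4 \<Rightarrow> real" where
  "cubic_disc f = (let a = f$1; b = f$2; c = f$3; d = f$4 in
     b^2 * c^2 - 4 * a * c^3 - 4 * b^3 * d - 27 * a^2 * d^2 + 18 * a * b * c * d)"

definition neg_disc_cubics :: "rp3 set" where
  "neg_disc_cubics = {proj_class f |f. cubic_disc f < 0}"

text \<open>Only meaningful on \<^const>\<open>neg_disc_cubics\<close>, where such a root exists and is unique.\<close>

lift_definition complex_root :: "rp3 \<Rightarrow> complex" is
  "\<lambda>f. THE z. Im z > 0 \<and> cubic_eval f z 1 = 0"
proof -
  fix f g assume "proj_rel f g"
  then obtain c where c: "c \<noteq> 0" "g = c *\<^sub>R f"
    by (auto simp: proj_rel_def)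
  have "cubic_eval g z 1 = of_real c * cubic_eval f z 1" for z
    by (simp add: c cubic_eval_def algebra_simps)
  with c show "(THE z. 0 < Im z \<and> cubic_eval f z 1 = 0) = (THE z. 0 < Im z \<and> cubic_eval g z 1 = 0)"
    by simp
qed

definition root_fiber :: "complex \<Rightarrow> rp3 set" where
  "root_fiber z = {p \<in> neg_disc_cubics. complex_root p = z}"

text \<open>
  The affine parametrizations of a projective plane \<open>P\<close>: for a basis \<open>u, v, w\<close> of the
  underlying three-dimensional space, \<open>(s, t) \<mapsto> [u + s v + t w]\<close> is a bijection from
  \<open>R^2\<close> onto the complement of a line in \<open>P\<close>. The inverses of these maps form an atlas
  for the smooth structure of \<open>P\<close>.
\<close>

definition plane_param :: "rp3 set \<Rightarrow> (real \<times> real \<Rightarrow> rp3) \<Rightarrow> bool" where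
  "plane_param P \<phi> \<longleftrightarrow> (\<exists>u v w. card {u, v, w} = 3 \<and> independent {u, v, w} \<and>
     \<phi> = (\<lambda>(s, t). proj_class (u + s *\<^sub>R v + t *\<^sub>R w)) \<and> range \<phi> \<subseteq> P)"

text \<open>
  The points of \<open>S = X \<inter> P\<close> at which the differential of the root map restricted to \<open>S\<close>,
  read in an affine chart of \<open>P\<close>, is not injective. As \<open>S\<close> is open in \<open>P\<close> and the root
  map is smooth there (the root is simple), the derivative exists in every chart around the
  point, and its injectivity does not depend on the chart.
\<close>

definition singular_locus :: "rp3 set \<Rightarrow> rp3 set" where
  "singular_locus P = {p \<in> neg_disc_cubics \<inter> P. \<exists>\<phi> x D. plane_param P \<phi> \<and> \<phi> x = p \<and>
     ((complex_root \<circ> \<phi>) has_derivative D) (at x) \<and> \<not> inj D}"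

definition quadratic_point :: "complex \<Rightarrow> bool" where
  "quadratic_point z \<longleftrightarrow> Im z \<noteq> 0 \<and>
     (\<exists>q :: rat poly. degree q = 2 \<and> irreducible q \<and> poly (map_poly of_rat q) z = 0)"

definition has_rational_linear_factor :: "real^4 \<Rightarrow> bool" where
  "has_rational_linear_factor f \<longleftrightarrow> (\<exists>s t k l m :: rat. (s, t) \<noteq> (0, 0) \<and>
     (\<forall>x y. cubic_eval f x y =
        (of_rat s * x + of_rat t * y) * (of_rat k * x^2 + of_rat l * x * y + of_rat m * y^2)))"

end

theory Submission
  imports Defs
begin

text \<open>
  The cubics with root \<open>z\<close> form a two-dimensional space \<open>W\<^sub>z\<close>. Differentiating the root
  equation at a simple root \<open>z\<close> of \<open>f\<close> shows that the root is stationary in direction \<open>g\<close>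
  iff \<open>g(z) = 0\<close>, so \<open>[f]\<close> is singular on a plane iff the plane contains \<open>W\<^sub>z\<close>. This is a
  linear system, rational in the normal vector, for the trace and the norm of \<open>z\<close>, and it has at most
  one solution with \<open>z\<close> in the upper half plane. So \<open>z\<close> is quadratic if the normal vector is
  rational, and for a quadratic \<open>z\<close> the system can be solved for a rational normal vector.
\<close>

section \<open>Real cubics with a prescribed complex root\<close>

lemma vec4_eq_iff: "(f :: real^4) = g \<longleftrightarrow> f$1 = g$1 \<and> f$2 = g$2 \<and> f$3 = g$3 \<and> f$4 = g$4"
  by (auto simp: vec_eq_iff forall_4)

lemma inner_vec4: "(n :: real^4) \<bullet> f = n$1 * f$1 + n$2 * f$2 + n$3 * f$3 + n$4 * f$4"
  by (simp add: inner_vec_def sum_4)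

text \<open>This is the product \<open>(a x + b y) (x - z y) (x - cnj z y)\<close>. Writing it with
  \<open>axis\<close> vectors lets the continuity and derivative rules treat it as a function of
  \<open>a\<close>, \<open>b\<close>, \<open>Re z\<close> and \<open>Im z\<close> together.\<close>

definition root_cubic :: "complex \<Rightarrow> real \<Rightarrow> real \<Rightarrow> real^4" where
  "root_cubic z a b =
     a *\<^sub>R (axis 1 1 - (2 * Re z) *\<^sub>R axis 2 1 + ((Re z)\<^sup>2 + (Im z)\<^sup>2) *\<^sub>R axis 3 1) +
     b *\<^sub>R (axis 2 1 - (2 * Re z) *\<^sub>R axis 3 1 + ((Re z)\<^sup>2 + (Im z)\<^sup>2) *\<^sub>R axis 4 1)"

lemma root_cubic_nth [simp]:
  "root_cubic z a b $ 1 = a"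
  "root_cubic z a b $ 2 = b - 2 * Re z * a"
  "root_cubic z a b $ 3 = ((Re z)\<^sup>2 + (Im z)\<^sup>2) * a - 2 * Re z * b"
  "root_cubic z a b $ 4 = ((Re z)\<^sup>2 + (Im z)\<^sup>2) * b"
  by (simp_all add: root_cubic_def axis_def)

lemma root_cubic_add: "root_cubic z a b + root_cubic z c d = root_cubic z (a + c) (b + d)"
  and root_cubic_scale: "r *\<^sub>R root_cubic z a b = root_cubic z (r * a) (r * b)"
  by (simp_all add: vec4_eq_iff algebra_simps)

lemma root_cubic_eq_0_iff: "root_cubic z a b = 0 \<longleftrightarrow> a = 0 \<and> b = 0"
  by (auto simp: vec4_eq_iff)

lemma cubic_eval_root_cubic:
  "cubic_eval (root_cubic z a b) x y =
     (of_real a * x + of_real b * y) * (x - z * y) * (x - cnj z * y)"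
proof -
  have 1: "of_real (2 * Re z) = z + cnj z"
    by (simp add: complex_add_cnj)
  have 2: "of_real ((Re z)\<^sup>2 + (Im z)\<^sup>2) = z * cnj z"
    by (simp add: complex_mult_cnj)
  show ?thesis
    unfolding cubic_eval_def root_cubic_nth of_real_mult of_real_diff of_real_add[of "Re z ^ 2 * a"]
    unfolding of_real_diff of_real_mult 1[unfolded of_real_mult] 2
    by (simp add: algebra_simps power2_eq_square power3_eq_cube)
qed

text \<open>The quadratic factor has discriminant \<open>(z - cnj z)^2 = - 4 * (Im z)^2\<close>; its
  resultant with the linear factor is \<open>|a z + b|^2\<close>, which enters squared.\<close>

lemma cubic_disc_root_cubic:
  "cubic_disc (root_cubic z a b) =
     - 4 * (Im z)\<^sup>2 * ((a * Re z + b)\<^sup>2 + (a * Im z)\<^sup>2)\<^sup>2"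
  unfolding cubic_disc_def Let_def root_cubic_nth by algebra

lemma cubic_disc_root_cubic_neg:
  assumes "Im z > 0" "a \<noteq> 0 \<or> b \<noteq> 0"
  shows "cubic_disc (root_cubic z a b) < 0"
proof -
  have "(a * Re z + b)\<^sup>2 + (a * Im z)\<^sup>2 \<noteq> 0"
    using assms by (auto simp: sum_power2_eq_zero_iff)
  then have "(Im z)\<^sup>2 * ((a * Re z + b)\<^sup>2 + (a * Im z)\<^sup>2)\<^sup>2 > 0"
    using assms by (intro mult_pos_pos) auto
  then show ?thesis
    unfolding cubic_disc_root_cubic by linarith
qed

text \<open>A nonzero real linear form does not vanish off the real axis, and \<open>cnj z\<close>
  lies in the lower half plane, so \<open>x - z\<close> is the only factor left.\<close>

lemma cubic_eval_root_cubic_eq_0_iff: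
  assumes "Im z > 0" "a \<noteq> 0 \<or> b \<noteq> 0" "Im x > 0"
  shows "cubic_eval (root_cubic z a b) x 1 = 0 \<longleftrightarrow> x = z"
proof -
  have "of_real a * x + of_real b \<noteq> 0"
    using assms by (auto simp: complex_eq_iff)
  moreover have "x \<noteq> cnj z"
    using assms by (auto simp: complex_eq_iff)
  ultimately show ?thesis
    by (simp add: cubic_eval_root_cubic)
qed

text \<open>Match the coefficients of \<open>x^3\<close> and \<open>x^2 y\<close>. The remainder is
  \<open>y^2\<close> times a real linear form, which vanishes at a non-real point only if it is
  zero.\<close>

lemma cubic_eval_eq_0_imp_root_cubic:
  assumes "Im z \<noteq> 0" "cubic_eval f z 1 = 0"
  obtains a b where "f = root_cubic z a b"
proof -
  define b where "b = f$2 + 2 * Re z * f$1"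
  define N where "N = (Re z)\<^sup>2 + (Im z)\<^sup>2"
  define g where "g = f - root_cubic z (f$1) b"
  have g12: "g$1 = 0" "g$2 = 0"
    by (simp_all add: g_def b_def)
  have "cubic_eval g z 1 = cubic_eval f z 1 - cubic_eval (root_cubic z (f$1) b) z 1"
    by (simp add: g_def cubic_eval_def algebra_simps)
  also have "\<dots> = 0"
    using assms by (simp add: cubic_eval_root_cubic)
  finally have "of_real (g$3) * z + of_real (g$4) = 0"
    by (simp add: cubic_eval_def g12)
  then have "g$3 = 0 \<and> g$4 = 0"
    using assms by (auto simp: complex_eq_iff)
  with g12 have "g = 0"
    by (simp add: vec4_eq_iff)
  then show thesis
    using that by (simp add: g_def)
qed

text \<open>The discriminant of \<open>(a x + b y) (x\<^sup>2 + p x y + q y\<^sup>2)\<close> is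
  \<open>p\<^sup>2 - 4 q\<close> times a square, so only the existence of some root has to be established.\<close>

lemma neg_disc_imp_root_cubic:
  assumes "cubic_disc f < 0"
  obtains z a b where "Im z > 0" "a \<noteq> 0 \<or> b \<noteq> 0" "f = root_cubic z a b"
proof -
  have quad: "\<exists>z. Im z > 0 \<and> of_real A * z\<^sup>2 + of_real B * z + of_real C = 0"
    if "B\<^sup>2 - 4 * A * C < 0" for A B C :: real
  proof -
    define s where "s = sqrt (4 * A * C - B\<^sup>2)"
    have s: "s > 0" "s\<^sup>2 = 4 * A * C - B\<^sup>2"
      using that by (auto simp: s_def)
    have A: "A \<noteq> 0"
      using that by (auto simp: power2_eq_square)
    \<comment> \<open>The quadratic formula; the absolute value of \<open>A\<close> selects the root
      in the upper half plane for either sign of \<open>A\<close>.\<close>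
    define z where "z = Complex (- B / (2 * A)) (s / (2 * \<bar>A\<bar>))"
    have "A * (Re z)\<^sup>2 - A * (Im z)\<^sup>2 + B * Re z + C = 0"
    proof -
      have im: "(Im z)\<^sup>2 = (4 * A * C - B\<^sup>2) / (4 * A\<^sup>2)"
        using s(2) by (simp add: z_def power_divide power_mult_distrib)
      show ?thesis
        unfolding im using A by (simp add: z_def field_simps power2_eq_square)
    qed
    moreover have "2 * A * Re z * Im z + B * Im z = 0"
      using A by (simp add: z_def field_simps)
    ultimately have "of_real A * z\<^sup>2 + of_real B * z + of_real C = 0"
      by (simp add: complex_eq_iff power2_eq_square algebra_simps)
    moreover have "Im z > 0"
      using A s(1) by (simp add: z_def)
    ultimately show ?thesis by blast
  qed
  have "\<exists>z. Im z > 0 \<and> cubic_eval f z 1 = 0"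
  proof (cases "f$1 = 0")
    case True
    \<comment> \<open>Here one real root is at infinity: the cubic is \<open>y\<close> times a
      quadratic form.\<close>
    have "cubic_disc f = (f$2)\<^sup>2 * ((f$3)\<^sup>2 - 4 * f$2 * f$4)"
      unfolding cubic_disc_def Let_def using True by algebra
    then have "(f$3)\<^sup>2 - 4 * f$2 * f$4 < 0"
      using assms by (metis mult_nonneg_nonneg not_less zero_le_power2)
    from quad[OF this] show ?thesis
      using True by (simp add: cubic_eval_def)
  next
    case False
    define p where "p = [:of_real (f$4), of_real (f$3), of_real (f$2), of_real (f$1) :: complex:]"
    have p: "poly p z = cubic_eval f z 1" for z
      by (simp add: p_def cubic_eval_def algebra_simps power2_eq_square power3_eq_cube)
    have "degree p = 3"
      using False by (simp add: p_def)
    then have "\<not> constant (poly p)"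
      by (simp add: constant_degree)
    then obtain r where r: "cubic_eval f r 1 = 0"
      using fundamental_theorem_of_algebra p by metis
    show ?thesis
    proof (cases "Im r = 0")
      case False
      have "cubic_eval f (cnj r) 1 = cnj (cubic_eval f r 1)"
        by (simp add: cubic_eval_def)
      with r have "cubic_eval f (cnj r) 1 = 0" by simp
      with r False show ?thesis
        by (metis cnj.simps(2) linorder_neqE_linordered_idom neg_0_less_iff_less)
    next
      case True
      define t where "t = Re r"
      have rt: "r = of_real t"
        using True by (simp add: t_def complex_eq_iff)
      \<comment> \<open>Synthetic division by \<open>x - t y\<close>: the quotient has coefficients
        \<open>f$1\<close>, \<open>B\<close>, \<open>C\<close>.\<close>
      define B where "B = f$2 + t * f$1"
      define C where "C = f$3 + t * B"
      have "of_real (f$1 * t^3 + f$2 * t^2 + f$3 * t + f$4) = (0::complex)"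
        using r by (simp add: rt cubic_eval_def)
      then have f4: "f$4 = - t * C"
        unfolding of_real_eq_0_iff B_def C_def by algebra
      have f3: "f$3 = C - t * B" and f2: "f$2 = B - t * f$1"
        by (simp_all add: B_def C_def)
      have "cubic_disc f = (f$1 * t\<^sup>2 + B * t + C)\<^sup>2 * (B\<^sup>2 - 4 * f$1 * C)"
        unfolding cubic_disc_def Let_def f4 f3 f2 by algebra
      then have "B\<^sup>2 - 4 * f$1 * C < 0"
        using assms by (metis mult_nonneg_nonneg not_less zero_le_power2)
      from quad[OF this] obtain z
        where z: "Im z > 0" "of_real (f$1) * z\<^sup>2 + of_real B * z + of_real C = 0"
        by blast
      have "cubic_eval f z 1 = (z - of_real t) * (of_real (f$1) * z\<^sup>2 + of_real B * z + of_real C)"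
        unfolding cubic_eval_def f4 f3 f2
        by (simp add: algebra_simps power2_eq_square power3_eq_cube)
      with z show ?thesis by auto
    qed
  qed
  then obtain z where z: "Im z > 0" "cubic_eval f z 1 = 0" by blast
  then obtain a b where f: "f = root_cubic z a b"
    using cubic_eval_eq_0_imp_root_cubic[of z f] by auto
  have "a \<noteq> 0 \<or> b \<noteq> 0"
    using assms by (auto simp: f cubic_disc_root_cubic)
  with z f show thesis using that by blast
qed

section \<open>Projective classes and the fibers of the root map\<close>

lemma proj_class_eq_iff:
  assumes "f \<noteq> 0" "g \<noteq> 0"
  shows "proj_class f = proj_class g \<longleftrightarrow> (\<exists>c. c \<noteq> 0 \<and> g = c *\<^sub>R f)"
proof -
  have "proj_rel f f" "proj_rel g g"
    using assms by (auto simp: proj_rel_def intro: exI[of _ 1])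
  then have "proj_class f = proj_class g \<longleftrightarrow> proj_rel f g"
    unfolding proj_class_def using Quotient_rel[OF Quotient_rp3] by metis
  then show ?thesis
    using assms by (simp add: proj_rel_def)
qed

lemma complex_root_proj_class:
  assumes "f \<noteq> 0"
  shows "complex_root (proj_class f) = (THE z. Im z > 0 \<and> cubic_eval f z 1 = 0)"
  unfolding proj_class_def
  by (rule complex_root.abs_eq) (use assms in \<open>auto simp: proj_rel_def intro: exI[of _ 1]\<close>)

lemma complex_root_root_cubic:
  assumes "Im z > 0" "a \<noteq> 0 \<or> b \<noteq> 0"
  shows "complex_root (proj_class (root_cubic z a b)) = z"
proof -
  have "root_cubic z a b \<noteq> 0"
    using assms by (simp add: root_cubic_eq_0_iff)
  then show ?thesis
    unfolding complex_root_proj_class[OF \<open>root_cubic z a b \<noteq> 0\<close>]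
    using assms by (intro the_equality) (auto simp: cubic_eval_root_cubic_eq_0_iff)
qed

text \<open>The degree is even, so the sign of the discriminant depends only on the projective
  class.\<close>

lemma cubic_disc_scale: "cubic_disc (c *\<^sub>R f) = c ^ 4 * cubic_disc f"
  unfolding cubic_disc_def Let_def vector_scaleR_component real_scaleR_def by algebra

lemma cubic_disc_neg_nonzero: "cubic_disc f < 0 \<Longrightarrow> f \<noteq> 0"
  by (auto simp: cubic_disc_def)

lemma proj_class_in_neg_disc_iff:
  assumes "f \<noteq> 0"
  shows "proj_class f \<in> neg_disc_cubics \<longleftrightarrow> cubic_disc f < 0"
proof
  assume "proj_class f \<in> neg_disc_cubics"
  then obtain g where g: "proj_class f = proj_class g" "cubic_disc g < 0"
    by (auto simp: neg_disc_cubics_def)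
  with assms obtain c where c: "c \<noteq> 0" "g = c *\<^sub>R f"
    using proj_class_eq_iff[OF assms] cubic_disc_neg_nonzero by auto
  have "c ^ 4 > 0" using c by (simp add: zero_less_power_eq)
  with g c show "cubic_disc f < 0"
    by (simp add: cubic_disc_scale mult_less_0_iff)
qed (auto simp: neg_disc_cubics_def)

lemma proj_class_in_plane_normal_iff:
  assumes "f \<noteq> 0"
  shows "proj_class f \<in> plane_normal n \<longleftrightarrow> n \<bullet> f = 0"
proof
  assume "proj_class f \<in> plane_normal n"
  then obtain g where g: "proj_class f = proj_class g" "g \<noteq> 0" "n \<bullet> g = 0"
    by (auto simp: plane_normal_def)
  with assms obtain c where "c \<noteq> 0" "g = c *\<^sub>R f"
    using proj_class_eq_iff[OF assms] by auto
  with g show "n \<bullet> f = 0" by simp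
qed (use assms in \<open>auto simp: plane_normal_def\<close>)

lemma root_fiber_eq:
  assumes "Im z > 0"
  shows "root_fiber z = {proj_class (root_cubic z a b) |a b. a \<noteq> 0 \<or> b \<noteq> 0}"
proof (intro equalityI subsetI)
  fix p assume "p \<in> root_fiber z"
  then obtain f where f: "p = proj_class f" "cubic_disc f < 0" "complex_root p = z"
    by (auto simp: root_fiber_def neg_disc_cubics_def)
  from f(2) obtain y a b where "Im y > 0" "a \<noteq> 0 \<or> b \<noteq> 0" "f = root_cubic y a b"
    by (rule neg_disc_imp_root_cubic)
  with f show "p \<in> {proj_class (root_cubic z a b) |a b. a \<noteq> 0 \<or> b \<noteq> 0}"
    using complex_root_root_cubic by auto
next
  fix p assume "p \<in> {proj_class (root_cubic z a b) |a b. a \<noteq> 0 \<or> b \<noteq> 0}"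
  then show "p \<in> root_fiber z"
    using assms complex_root_root_cubic cubic_disc_root_cubic_neg
    by (auto simp: root_fiber_def neg_disc_cubics_def)
qed

lemma root_fiber_proj_line:
  assumes "Im z > 0"
  shows "proj_line (root_fiber z)"
proof -
  define W where "W = span {root_cubic z 1 0, root_cubic z 0 1}"
  have W: "W = {root_cubic z a b |a b. True}"
    by (auto simp: W_def span_insert span_singleton root_cubic_scale algebra_simps root_cubic_add
        eq_diff_eq)
  have "independent {root_cubic z 1 0, root_cubic z 0 1}"
    by (auto simp: independent_insert span_singleton root_cubic_scale vec4_eq_iff)
  moreover have "root_cubic z 1 0 \<noteq> root_cubic z 0 1"
    by (simp add: vec4_eq_iff)
  ultimately have "dim W = 2"
    by (simp add: W_def dim_eq_card_independent)
  moreover have "root_fiber z = {proj_class f |f. f \<in> W \<and> f \<noteq> 0}"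
    using assms by (auto simp: root_fiber_eq W root_cubic_eq_0_iff; metis root_cubic_eq_0_iff)
  ultimately show ?thesis
    unfolding proj_line_def using subspace_span[of "{root_cubic z 1 0, root_cubic z 0 1}"] W_def by blast
qed

lemma plane_contains_root_fiber_iff:
  "(\<forall>a b. n \<bullet> root_cubic z a b = 0) \<longleftrightarrow>
     n \<bullet> root_cubic z 1 0 = 0 \<and> n \<bullet> root_cubic z 0 1 = 0"
proof -
  have "root_cubic z a b = a *\<^sub>R root_cubic z 1 0 + b *\<^sub>R root_cubic z 0 1" for a b
    by (simp add: root_cubic_scale root_cubic_add)
  then show ?thesis
    by (metis inner_add_right inner_scaleR_right mult_zero_right add_0)
qed

section \<open>Differentiability of the root map\<close>

lemma open_neg_disc: "open {f. cubic_disc f < 0}"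
  unfolding cubic_disc_def Let_def by (intro open_Collect_less continuous_intros)

text \<open>By uniqueness of the factorization, the root is, near \<open>f\<close>, a component of an inverse of
  \<open>v \<mapsto> (v\<^sub>1 x + v\<^sub>2 y) (x\<^sup>2 - 2 v\<^sub>3 x y + (v\<^sub>3\<^sup>2 + v\<^sub>4\<^sup>2) y\<^sup>2)\<close>, whose
  derivative is invertible because the roots are simple.\<close>

lemma complex_root_differentiable:
  assumes "cubic_disc f < 0"
  shows "(\<lambda>g. complex_root (proj_class g)) differentiable (at f)"
proof -
  obtain z a b where z: "Im z > 0" and ab: "a \<noteq> 0 \<or> b \<noteq> 0" and f: "f = root_cubic z a b"
    using assms by (rule neg_disc_imp_root_cubic)
  define M :: "real^4 \<Rightarrow> real^4" where
    "M v = root_cubic (Complex (v$3) (v$4)) (v$1) (v$2)" for v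
  \<comment> \<open>A nonzero linear factor and a root in the upper half plane: on this set the
    factorization is unique, so \<open>M\<close> is injective.\<close>
  define S :: "(real^4) set" where "S = {v. 0 < v$4} \<inter> ({v. v$1 \<noteq> 0} \<union> {v. v$2 \<noteq> 0})"
  define v0 :: "real^4" where "v0 = vector [a, b, Re z, Im z]"
  have v0: "v0$1 = a" "v0$2 = b" "v0$3 = Re z" "v0$4 = Im z"
    by (simp_all add: v0_def vector_def)
  define M' :: "real^4 \<Rightarrow> real^4" where
    "M' h = root_cubic z (h$1) (h$2) +
       a *\<^sub>R ((- 2 * h$3) *\<^sub>R axis 2 1 + (2 * Re z * h$3 + 2 * Im z * h$4) *\<^sub>R axis 3 1) +
       b *\<^sub>R ((- 2 * h$3) *\<^sub>R axis 3 1 + (2 * Re z * h$3 + 2 * Im z * h$4) *\<^sub>R axis 4 1)" for h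
  have M': "(M has_derivative M') (at v0)"
    unfolding M_def[abs_def] M'_def[abs_def] root_cubic_def complex.sel
    by (auto intro!: derivative_eq_intros bounded_linear.has_derivative[OF bounded_linear_vec_nth]
        simp: v0 fun_eq_iff vec4_eq_iff axis_def algebra_simps)
  have "linear M'"
    using M' has_derivative_linear by blast
  \<comment> \<open>The derivative splits into varying the linear factor, which keeps the root
    \<open>z\<close>, and varying the quadratic factor by \<open>y (p x + q y)\<close>. Evaluation
    at \<open>z\<close> removes the first part and leaves \<open>(a z + b) (p z + q) = 0\<close>,
    where the first factor is nonzero.\<close>
  have "h = 0" if "M' h = 0" for h
  proof -
    define p q where "p = - 2 * h$3" and "q = 2 * Re z * h$3 + 2 * Im z * h$4"
    define k where "k = a *\<^sub>R (p *\<^sub>R axis 2 1 + q *\<^sub>R axis 3 1) +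
      b *\<^sub>R (p *\<^sub>R axis 3 1 + q *\<^sub>R axis 4 1 :: real^4)"
    have k: "k$1 = 0" "k$2 = a * p" "k$3 = a * q + b * p" "k$4 = b * q"
      by (simp_all add: k_def axis_def)
    have M'h: "root_cubic z (h$1) (h$2) + k = 0"
      using that by (simp add: M'_def k_def p_def q_def add.assoc)
    have "cubic_eval (root_cubic z (h$1) (h$2) + k) z 1
        = cubic_eval (root_cubic z (h$1) (h$2)) z 1 + cubic_eval k z 1"
      by (simp add: cubic_eval_def algebra_simps)
    moreover have "cubic_eval (0 :: real^4) z 1 = 0"
      by (simp add: cubic_eval_def)
    ultimately have "cubic_eval k z 1 = 0"
      unfolding M'h by (simp add: cubic_eval_root_cubic)
    moreover have "cubic_eval k z 1 = (of_real a * z + of_real b) * (of_real p * z + of_real q)"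
      by (simp add: cubic_eval_def k algebra_simps power2_eq_square)
    moreover have "of_real a * z + of_real b \<noteq> 0"
      using z ab by (auto simp: complex_eq_iff)
    ultimately have "of_real p * z + of_real q = 0"
      by auto
    then have "p = 0" "q = 0"
      using z by (auto simp: complex_eq_iff)
    then have "h$3 = 0" "h$4 = 0" "k = 0"
      using z by (auto simp: p_def q_def k_def)
    moreover from this M'h have "h$1 = 0" "h$2 = 0"
      by (auto simp: root_cubic_eq_0_iff)
    ultimately show ?thesis
      by (simp add: vec4_eq_iff)
  qed
  then have "inj M'"
    using \<open>linear M'\<close> by (simp add: linear_injective_0)
  then obtain N' where N': "M' \<circ> N' = id"
    using linear_injective_isomorphism[OF \<open>linear M'\<close>] by (auto simp: fun_eq_iff)
  have S: "open S"
    unfolding S_def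
    by (intro open_Int open_Un open_Collect_less open_Collect_neq continuous_intros)
  have root: "complex_root (proj_class (M v)) = Complex (v$3) (v$4)" if "v \<in> S" for v
    unfolding M_def by (rule complex_root_root_cubic) (use that in \<open>auto simp: S_def\<close>)
  have inj: "inj_on M S"
  proof (rule inj_onI)
    fix v w assume "v \<in> S" "w \<in> S" and eq: "M v = M w"
    then have "Complex (v$3) (v$4) = Complex (w$3) (w$4)"
      using root by metis
    moreover from this eq have "v$1 = w$1" "v$2 = w$2"
      unfolding M_def vec4_eq_iff by auto
    ultimately show "v = w"
      by (simp add: vec4_eq_iff)
  qed
  define N where "N = inv_into S M"
  have NM: "N (M v) = v" if "v \<in> S" for v
    using inj that by (simp add: N_def)
  have Mv0: "M v0 = f"
    by (simp add: M_def v0 f)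
  \<comment> \<open>Inverse function theorem, from a left inverse \<open>N\<close> of
    \<open>M\<close> on the open set \<open>S\<close> and a right inverse \<open>N'\<close> of the
    derivative.\<close>
  have "(N has_derivative N') (at (M v0))"
  proof (rule has_derivative_inverse_strong[where f = M and x = v0 and f' = M', OF S])
    show "v0 \<in> S"
      using z ab by (simp add: S_def v0)
    show "continuous_on S M"
      unfolding M_def root_cubic_def complex.sel by (intro continuous_intros)
  qed (fact NM M' N')+
  then have "((\<lambda>g. of_real (N g $ 3) + \<i> * of_real (N g $ 4) :: complex) has_derivative
      (\<lambda>h. of_real (N' h $ 3) + \<i> * of_real (N' h $ 4))) (at f)"
    unfolding Mv0 by (auto intro!: derivative_eq_intros
      bounded_linear.has_derivative[OF bounded_linear_vec_nth])
  moreover have "f \<in> {g. cubic_disc g < 0}"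
    using assms by simp
  \<comment> \<open>Every cubic of negative discriminant is \<open>M v\<close> for some
    \<open>v\<close> in \<open>S\<close>, so \<open>N\<close> computes the root on a whole
    neighborhood of \<open>f\<close>.\<close>
  moreover have "of_real (N g $ 3) + \<i> * of_real (N g $ 4) = complex_root (proj_class g)"
    if "g \<in> {g. cubic_disc g < 0}" for g
  proof -
    have "cubic_disc g < 0"
      using that by simp
    then obtain y c d where y: "Im y > 0" "c \<noteq> 0 \<or> d \<noteq> 0" "g = root_cubic y c d"
      by (rule neg_disc_imp_root_cubic)
    define v :: "real^4" where "v = vector [c, d, Re y, Im y]"
    have v: "v$1 = c" "v$2 = d" "v$3 = Re y" "v$4 = Im y"
      by (simp_all add: v_def vector_def)
    have "v \<in> S" and "M v = g"
      using y by (simp_all add: S_def M_def v)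
    then have "N g = v" "complex_root (proj_class g) = Complex (v$3) (v$4)"
      using NM root by auto
    then show ?thesis
      by (simp add: complex_eq_iff)
  qed
  ultimately have "((\<lambda>g. complex_root (proj_class g)) has_derivative
      (\<lambda>h. of_real (N' h $ 3) + \<i> * of_real (N' h $ 4))) (at f)"
    by (rule has_derivative_transform_within_open[OF _ open_neg_disc])
  then show ?thesis
    by (auto simp: differentiable_def)
qed

section \<open>Singular points and fibers contained in the plane\<close>

lemma cubic_eval_complex_root:
  assumes "cubic_disc f < 0"
  shows "cubic_eval f (complex_root (proj_class f)) 1 = 0"
proof -
  obtain z a b where "Im z > 0" "a \<noteq> 0 \<or> b \<noteq> 0" "f = root_cubic z a b"
    using assms by (rule neg_disc_imp_root_cubic)
  then show ?thesis
    by (simp add: complex_root_root_cubic cubic_eval_root_cubic)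
qed

text \<open>Independence concerns the set \<open>{u, v, w}\<close>; the cardinality makes the three
  vectors distinct, so that coefficients can be compared.\<close>

lemma independent3:
  fixes u v w :: "real^4"
  assumes "card {u, v, w} = 3" "independent {u, v, w}" "r *\<^sub>R u + s *\<^sub>R v + t *\<^sub>R w = 0"
  shows "r = 0 \<and> s = 0 \<and> t = 0"
proof -
  have d: "u \<noteq> v" "u \<noteq> w" "v \<noteq> w"
    using assms(1) by (auto simp: card_insert_if split: if_splits)
  define c where "c x = (if x = u then r else if x = v then s else t)" for x
  have "(\<Sum>x\<in>{u, v, w}. c x *\<^sub>R x) = 0"
    using d assms(3) by (simp add: c_def add.assoc)
  then have "\<forall>x\<in>{u, v, w}. c x = 0"
    using assms(2) independent_explicit_finite_subsets[of "{u, v, w}"] by blast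
  then show ?thesis
    using d by (auto simp: c_def split: if_splits)
qed

text \<open>Differentiating \<open>F(R(F)) = 0\<close> along the plane gives \<open>f'(z) DR(g) + g(z) = 0\<close>, so a kernel
  vector of the differential is a second cubic in the plane with root \<open>z\<close>.\<close>

lemma singular_imp_plane_contains_fiber:
  assumes "p \<in> singular_locus (plane_normal n)"
  shows "\<exists>z. Im z > 0 \<and> p \<in> root_fiber z \<and> (\<forall>a b. n \<bullet> root_cubic z a b = 0)"
proof -
  obtain \<phi> x D where p: "p \<in> neg_disc_cubics" and \<phi>: "plane_param (plane_normal n) \<phi>" "\<phi> x = p"
    and D: "((complex_root \<circ> \<phi>) has_derivative D) (at x)" "\<not> inj D"
    using assms by (auto simp: singular_locus_def)
  obtain u v w where uvw: "card {u, v, w} = 3" "independent {u, v, w}"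
    and \<phi>_eq: "\<phi> = (\<lambda>(s, t). proj_class (u + s *\<^sub>R v + t *\<^sub>R w))"
    and range: "range \<phi> \<subseteq> plane_normal n"
    using \<phi>(1) by (auto simp: plane_param_def)
  define F where "F = (\<lambda>y :: real \<times> real. u + fst y *\<^sub>R v + snd y *\<^sub>R w)"
  have \<phi>_F: "\<phi> y = proj_class (F y)" for y
    by (simp add: \<phi>_eq F_def case_prod_beta)
  have F_nz: "F y \<noteq> 0" for y
    using independent3[OF uvw, of 1 "fst y" "snd y"] by (auto simp: F_def)
  have nF: "n \<bullet> F y = 0" for y
    using range F_nz proj_class_in_plane_normal_iff \<phi>_F by (metis range_subsetD)
  have nu: "n \<bullet> u = 0" and nv: "n \<bullet> v = 0" and nw: "n \<bullet> w = 0"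
    using nF[of "(0, 0)"] nF[of "(1, 0)"] nF[of "(0, 1)"]
    by (auto simp: F_def inner_add_right)
  have disc: "cubic_disc (F x) < 0"
    using p \<phi>(2) F_nz by (simp add: \<phi>_F flip: proj_class_in_neg_disc_iff)
  then obtain z a b where z: "Im z > 0" and ab: "a \<noteq> 0 \<or> b \<noteq> 0" and Fx: "F x = root_cubic z a b"
    by (rule neg_disc_imp_root_cubic)
  define R where "R = complex_root \<circ> \<phi>"
  have Rx: "R x = z"
    using z ab by (simp add: R_def \<phi>_F Fx complex_root_root_cubic)
  have "linear D"
    using D(1) has_derivative_linear by blast
  then obtain h where h: "D h = 0" "h \<noteq> 0"
    using D(2) by (auto simp: linear_injective_0)
  define g where "g = fst h *\<^sub>R v + snd h *\<^sub>R w"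
  define G where "G = (\<lambda>y. cubic_eval (F y) (R y) 1)"
  have R: "(R has_derivative D) (at x)"
    using D(1) by (simp add: R_def)
  define c where "c i y = complex_of_real (F y $ i)" for i y
  define c' where "c' i k = complex_of_real ((fst k *\<^sub>R v + snd k *\<^sub>R w) $ i)"
    for i and k :: "real \<times> real"
  have c: "(c i has_derivative c' i) (at x)" for i
    unfolding c_def c'_def F_def by (auto intro!: derivative_eq_intros)
  have contF: "continuous_on UNIV F"
    unfolding F_def by (intro continuous_intros)
  \<comment> \<open>\<open>G\<close> vanishes near \<open>x\<close>, so its derivative there is
    zero; the product rule then gives a second expression for it.\<close>
  have "open (F -` {f. cubic_disc f < 0})"
    using open_vimage[OF open_neg_disc] contF by auto
  moreover have "G y = 0" if "y \<in> F -` {f. cubic_disc f < 0}" for y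
    using that by (simp add: G_def R_def \<phi>_F cubic_eval_complex_root)
  ultimately have "(G has_derivative (\<lambda>_. 0)) (at x)"
    using disc by (intro has_derivative_transform_within_open[OF has_derivative_const]) auto
  moreover have "(G has_derivative (\<lambda>k. (3 * c 1 x * z\<^sup>2 + 2 * c 2 x * z + c 3 x) * D k +
      (c' 1 k * z^3 + c' 2 k * z\<^sup>2 + c' 3 k * z + c' 4 k))) (at x)"
    unfolding G_def cubic_eval_def c_def[symmetric]
    by (auto intro!: derivative_eq_intros R c
        simp: Rx algebra_simps power2_eq_square power3_eq_cube)
  ultimately have "(\<lambda>k. (3 * c 1 x * z\<^sup>2 + 2 * c 2 x * z + c 3 x) * D k +
      (c' 1 k * z^3 + c' 2 k * z\<^sup>2 + c' 3 k * z + c' 4 k)) = (\<lambda>_. 0)"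
    by (rule has_derivative_unique[rotated])
  from fun_cong[OF this, of h] have "cubic_eval g z 1 = 0"
    using h by (simp add: cubic_eval_def g_def c'_def)
  then obtain a' b' where g: "g = root_cubic z a' b'"
    using z cubic_eval_eq_0_imp_root_cubic[of z g] by auto
  \<comment> \<open>The values of \<open>n\<close> on a basis of the cubics with root
    \<open>z\<close>. Both \<open>F x\<close> and \<open>g\<close> lie in the plane, which gives two
    linear equations for \<open>A\<close> and \<open>B\<close>.\<close>
  define A B where "A = n \<bullet> root_cubic z 1 0" and "B = n \<bullet> root_cubic z 0 1"
  have AB: "n \<bullet> root_cubic z c d = c * A + d * B" for c d
  proof -
    have "root_cubic z c d = c *\<^sub>R root_cubic z 1 0 + d *\<^sub>R root_cubic z 0 1"
      by (simp add: root_cubic_scale root_cubic_add)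
    then show ?thesis
      by (simp add: A_def B_def inner_add_right)
  qed
  have eqs: "a * A + b * B = 0" "a' * A + b' * B = 0"
    using nF[of x] nv nw by (simp_all add: Fx flip: AB g) (simp add: g_def inner_add_right)
  \<comment> \<open>\<open>F x\<close> and \<open>g\<close> are independent: \<open>F x\<close> has
    coefficient 1 at \<open>u\<close>, while \<open>g\<close> is a nonzero combination of
    \<open>v\<close> and \<open>w\<close>.\<close>
  have det: "a * b' - b * a' \<noteq> 0"
  proof
    assume "a * b' - b * a' = 0"
    then have "a' *\<^sub>R F x = a *\<^sub>R g" "b' *\<^sub>R F x = b *\<^sub>R g"
      by (simp_all add: Fx g root_cubic_scale mult.commute)
    moreover have "r = 0 \<and> s = 0" if "r *\<^sub>R F x = s *\<^sub>R g" for r s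
    proof -
      have "r *\<^sub>R u + (r * fst x - s * fst h) *\<^sub>R v + (r * snd x - s * snd h) *\<^sub>R w = 0"
        using that by (simp add: F_def g_def algebra_simps)
      from independent3[OF uvw this] show ?thesis
        using h(2) by (auto simp: prod_eq_iff)
    qed
    ultimately show False
      using ab by blast
  qed
  have "(a * b' - b * a') * A = 0" "(a * b' - b * a') * B = 0"
    using eqs by algebra+
  then have "A = 0" "B = 0"
    using det by auto
  then have "\<forall>c d. n \<bullet> root_cubic z c d = 0"
    by (simp add: AB)
  moreover have "p = proj_class (root_cubic z a b)"
    using \<phi>(2) by (simp add: \<phi>_F Fx)
  then have "p \<in> root_fiber z"
    using ab root_fiber_eq[OF z] by blast
  ultimately show ?thesis
    using z by blast
qed

text \<open>Choose a chart centered at \<open>p\<close> whose first coordinate line runs inside the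
  fiber. The root is constant along that line, so the differential kills
  \<open>(1, 0)\<close>.\<close>

lemma plane_contains_fiber_imp_singular:
  assumes "n \<noteq> 0" and z: "Im z > 0" and n: "\<And>a b. n \<bullet> root_cubic z a b = 0"
    and p: "p \<in> root_fiber z"
  shows "p \<in> singular_locus (plane_normal n)"
proof -
  obtain a b where ab: "a \<noteq> 0 \<or> b \<noteq> 0" and p_eq: "p = proj_class (root_cubic z a b)"
    using p z by (auto simp: root_fiber_eq)
  \<comment> \<open>The pair \<open>(- b, a)\<close> is orthogonal to \<open>(a, b)\<close>, so
    \<open>f\<close> and \<open>g\<close> span all cubics with root \<open>z\<close>.\<close>
  define f g where "f = root_cubic z a b" and "g = root_cubic z (- b) a"
  have ab2: "a\<^sup>2 + b\<^sup>2 \<noteq> 0"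
    using ab by (auto simp: sum_power2_eq_zero_iff)
  have "f \<notin> span {g}"
  proof
    assume "f \<in> span {g}"
    then obtain c where "f = c *\<^sub>R g"
      by (auto simp: span_singleton)
    then have "a = - c * b" "b = c * a"
      unfolding f_def g_def root_cubic_scale vec4_eq_iff by auto
    then have "a * a + b * b = 0" by algebra
    then show False
      using ab2 by (simp add: power2_eq_square)
  qed
  moreover have "g \<noteq> 0"
    using ab by (auto simp: g_def root_cubic_eq_0_iff)
  ultimately have fg: "independent {f, g}" "f \<noteq> g"
    by (auto simp: independent_insert span_base)
  \<comment> \<open>The third chart vector exists because the hyperplane has dimension 3 and the
    span has dimension 2.\<close>
  have "\<exists>w. n \<bullet> w = 0 \<and> w \<notin> span {f, g}"
  proof (rule ccontr)
    assume "\<not> ?thesis"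
    then have "{w. n \<bullet> w = 0} \<subseteq> span {f, g}" by blast
    then have "dim {w. n \<bullet> w = 0} \<le> dim (span {f, g})"
      by (rule dim_subset)
    also have "\<dots> = 2"
      using fg by (simp add: dim_eq_card_independent)
    finally show False
      using dim_hyperplane[OF \<open>n \<noteq> 0\<close>] by simp
  qed
  then obtain w where w: "n \<bullet> w = 0" "w \<notin> span {f, g}" by blast
  have w': "w \<noteq> f" "w \<noteq> g"
    using w by (auto simp: span_base)
  have ind: "independent {f, g, w}" "card {f, g, w} = 3"
  proof -
    have "{f, g, w} = insert w {f, g}" by auto
    then show "independent {f, g, w}"
      using w fg by (simp add: independent_insert)
    show "card {f, g, w} = 3"
      using fg w' by auto
  qed
  define F where "F = (\<lambda>y :: real \<times> real. f + fst y *\<^sub>R g + snd y *\<^sub>R w)"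
  define \<phi> where "\<phi> = (\<lambda>(s, t). proj_class (f + s *\<^sub>R g + t *\<^sub>R w))"
  have \<phi>_F: "\<phi> y = proj_class (F y)" for y
    by (simp add: \<phi>_def F_def case_prod_beta)
  have F_nz: "F y \<noteq> 0" for y
    using independent3[OF ind(2,1), of 1 "fst y" "snd y"] by (auto simp: F_def)
  have "n \<bullet> F y = 0" for y
    using n w by (simp add: F_def f_def g_def inner_add_right)
  then have "range \<phi> \<subseteq> plane_normal n"
    using F_nz by (auto simp: \<phi>_F proj_class_in_plane_normal_iff)
  then have "plane_param (plane_normal n) \<phi>"
    unfolding plane_param_def using ind \<phi>_def by blast
  moreover have F0: "F (0, 0) = f"
    by (simp add: F_def)
  moreover have "p \<in> neg_disc_cubics"
    using p by (simp add: root_fiber_def)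
  moreover have "p \<in> plane_normal n"
    using ab n by (simp add: p_eq proj_class_in_plane_normal_iff root_cubic_eq_0_iff)
  moreover obtain D where D: "((complex_root \<circ> \<phi>) has_derivative D) (at (0, 0))"
  proof -
    have "cubic_disc f < 0"
      using z ab by (simp add: f_def cubic_disc_root_cubic_neg)
    then have "(\<lambda>g. complex_root (proj_class g)) differentiable (at (F (0, 0)))"
      by (simp add: F0 complex_root_differentiable)
    moreover have "(F has_derivative (\<lambda>k. fst k *\<^sub>R g + snd k *\<^sub>R w)) (at (0, 0))"
      unfolding F_def by (auto intro!: derivative_eq_intros)
    then have "F differentiable (at (0, 0))"
      by (auto simp: differentiable_def)
    ultimately have "((\<lambda>g. complex_root (proj_class g)) \<circ> F) differentiable (at (0, 0))"
      by (intro differentiable_chain_at)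
    then show thesis
      using that by (auto simp: differentiable_def comp_def \<phi>_F)
  qed
  moreover have "\<not> inj D"
  proof -
    have "((complex_root \<circ> \<phi>) \<circ> (\<lambda>s. (s, 0)) has_derivative D \<circ> (\<lambda>s. (s, 0))) (at (0::real))"
      by (rule diff_chain_at) (auto intro!: derivative_eq_intros D)
    moreover have "(complex_root \<circ> \<phi>) \<circ> (\<lambda>s. (s, 0)) = (\<lambda>_. z)"
    proof
      fix s
      have "F (s, 0) = root_cubic z (a - s * b) (b + s * a)"
        by (simp add: F_def f_def g_def root_cubic_scale root_cubic_add)
      moreover from this have "a - s * b \<noteq> 0 \<or> b + s * a \<noteq> 0"
        using F_nz[of "(s, 0)"] by (auto simp: root_cubic_eq_0_iff)
      ultimately show "((complex_root \<circ> \<phi>) \<circ> (\<lambda>s. (s, 0))) s = z"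
        using z by (simp add: \<phi>_F complex_root_root_cubic)
    qed
    ultimately have "D \<circ> (\<lambda>s. (s, 0)) = (\<lambda>_. 0)"
      by (metis has_derivative_const has_derivative_unique)
    then have "D (0, 0) = D (1, 0)"
      by (metis comp_apply)
    then show ?thesis
      by (auto dest: injD)
  qed
  moreover have "\<phi> (0, 0) = p"
    by (simp add: \<phi>_F F0 p_eq f_def)
  ultimately show ?thesis
    unfolding singular_locus_def by blast
qed

section \<open>The linear system for trace and norm\<close>

text \<open>The plane with normal \<open>n\<close> contains the fiber over \<open>z\<close> iff the trace \<open>t\<close> and norm \<open>m\<close>
  of \<open>z\<close> solve a linear \<open>2 \<times> 2\<close> system. On \<open>t\<^sup>2 < 4 m\<close> a singular
  system would force \<open>n = 0\<close>: its kernel makes \<open>(n\<^sub>2, n\<^sub>3, n\<^sub>4)\<close> a geometric progression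
  whose ratio is a real root of \<open>m k\<^sup>2 - t k + 1\<close>.\<close>

lemma fiber_system_kernel_trivial:
  fixes n1 n2 n3 n4 t m d e :: real
  assumes "n1 = t * n2 - m * n3" "n2 = t * n3 - m * n4" "t\<^sup>2 < 4 * m"
    and "d * n2 = e * n3" "d * n3 = e * n4" "d \<noteq> 0 \<or> e \<noteq> 0"
  shows "n1 = 0 \<and> n2 = 0 \<and> n3 = 0 \<and> n4 = 0"
proof (cases "e = 0")
  case True
  then have "n2 = 0" "n3 = 0" using assms by auto
  moreover have "m > 0"
    using assms(3) zero_le_power2[of t] by linarith
  ultimately show ?thesis using assms by auto
next
  case False
  define k where "k = d / e"
  have n3: "n3 = k * n2" and n4: "n4 = k * n3"
    using False assms(4,5) by (simp_all add: k_def field_simps)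
  have "n2 * (m * k\<^sup>2 - t * k + 1) = 0"
    using assms(2) n3 n4 by algebra
  \<comment> \<open>Completing the square shows that the quadratic in \<open>k\<close> has no real
    root.\<close>
  moreover have "4 * m * (m * k\<^sup>2 - t * k + 1) = (2 * m * k - t)\<^sup>2 + (4 * m - t\<^sup>2)"
    by algebra
  then have "4 * m * (m * k\<^sup>2 - t * k + 1) > 0"
    using assms(3) by (simp add: add_nonneg_pos)
  ultimately have "n2 = 0" by auto
  then show ?thesis using n3 n4 assms(1) by simp
qed

text \<open>The two equations say that \<open>n\<close> annihilates \<open>y Q\<close> and
  \<open>x Q\<close>, where \<open>Q = (x - z y) (x - cnj z y)\<close>; they appear as the second
  and first conjunct respectively.\<close>

lemma fiber_in_plane_iff:
  "(\<forall>a b. n \<bullet> root_cubic z a b = 0) \<longleftrightarrow>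
     n$1 = 2 * Re z * n$2 - ((Re z)\<^sup>2 + (Im z)\<^sup>2) * n$3 \<and>
     n$2 = 2 * Re z * n$3 - ((Re z)\<^sup>2 + (Im z)\<^sup>2) * n$4"
  unfolding plane_contains_root_fiber_iff
  unfolding inner_vec4 root_cubic_nth
  by (simp add: algebra_simps)

lemma trace_norm_disc: "Im z > 0 \<Longrightarrow> (2 * Re z)\<^sup>2 < 4 * ((Re z)\<^sup>2 + (Im z)\<^sup>2)"
  by (simp add: power_mult_distrib)

text \<open>Subtracting the systems for \<open>z\<close> and \<open>y\<close> puts the differences
  of trace and norm into the kernel, which is trivial since \<open>n\<close> is nonzero. Trace and
  norm determine a point of the upper half plane.\<close>

lemma fiber_in_plane_unique:
  assumes "n \<noteq> 0" and z: "Im z > 0" and y: "Im y > 0"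
    and nz: "\<forall>a b. n \<bullet> root_cubic z a b = 0" and ny: "\<forall>a b. n \<bullet> root_cubic y a b = 0"
  shows "y = z"
proof -
  define d e where "d = 2 * Re z - 2 * Re y"
    and "e = ((Re z)\<^sup>2 + (Im z)\<^sup>2) - ((Re y)\<^sup>2 + (Im y)\<^sup>2)"
  note eqz = nz[unfolded fiber_in_plane_iff] and eqy = ny[unfolded fiber_in_plane_iff]
  have de: "d * n$2 = e * n$3" "d * n$3 = e * n$4"
    unfolding d_def e_def using eqz eqy by algebra+
  have "d = 0 \<and> e = 0"
  proof (rule ccontr)
    assume "\<not> (d = 0 \<and> e = 0)"
    then have "d \<noteq> 0 \<or> e \<noteq> 0" by blast
    from fiber_system_kernel_trivial[OF conjunct1[OF eqz] conjunct2[OF eqz] trace_norm_disc[OF z] de this]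
    have "n = 0" by (simp add: vec4_eq_iff)
    with \<open>n \<noteq> 0\<close> show False by blast
  qed
  then have "Re z = Re y" "(Im z)\<^sup>2 = (Im y)\<^sup>2"
    by (auto simp: d_def e_def)
  then show ?thesis
    using z y by (simp add: complex_eq_iff power2_eq_iff)
qed

lemma singular_locus_eq_fiber:
  assumes "n \<noteq> 0" "Im z > 0" "\<forall>a b. n \<bullet> root_cubic z a b = 0"
  shows "singular_locus (plane_normal n) = root_fiber z"
proof (intro equalityI subsetI)
  fix p assume "p \<in> singular_locus (plane_normal n)"
  from singular_imp_plane_contains_fiber[OF this] obtain y
    where "Im y > 0" "p \<in> root_fiber y" "\<forall>a b. n \<bullet> root_cubic y a b = 0"
    by blast
  then show "p \<in> root_fiber z"
    using fiber_in_plane_unique[OF assms(1,2) _ assms(3)] by blast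
qed (use assms plane_contains_fiber_imp_singular in blast)

lemma singular_locus_cases:
  assumes "n \<noteq> 0" "singular_locus (plane_normal n) \<noteq> {}"
  obtains z where "Im z > 0" "\<forall>a b. n \<bullet> root_cubic z a b = 0"
    "singular_locus (plane_normal n) = root_fiber z"
proof -
  obtain p where "p \<in> singular_locus (plane_normal n)"
    using assms(2) by blast
  from singular_imp_plane_contains_fiber[OF this] obtain z
    where "Im z > 0" "\<forall>a b. n \<bullet> root_cubic z a b = 0"
    by blast
  with singular_locus_eq_fiber[OF assms(1) this] show thesis
    using that by blast
qed

section \<open>Quadratic points and rational planes\<close>

lemma degree_2_irreducible_if_no_roots:
  fixes q :: "'a :: field poly"
  assumes deg: "degree q = 2" and no_root: "\<And>x. poly q x \<noteq> 0"
  shows "irreducible q"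
proof (rule irreducibleI)
  show "q \<noteq> 0"
    using deg by auto
  then show "\<not> q dvd 1"
    using deg by (simp add: is_unit_iff_degree)
next
  fix a b assume q: "q = a * b"
  have nz: "a \<noteq> 0" "b \<noteq> 0"
    using q deg by auto
  have "degree a \<noteq> 1"
  proof
    assume "degree a = 1"
    obtain c r where a: "a = pCons c r"
      by (rule pCons_cases)
    with \<open>degree a = 1\<close> have "degree r = 0" "r \<noteq> 0"
      by (auto split: if_splits)
    then obtain d where "r = [:d:]" "d \<noteq> 0"
      by (auto elim: degree_eq_zeroE)
    with a have "poly q (- c / d) = 0"
      by (simp add: q)
    with no_root show False by blast
  qed
  moreover have "degree a + degree b = 2"
    using nz deg by (simp add: q degree_mult_eq)
  ultimately have "degree a = 0 \<or> degree b = 0" by linarith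
  then show "a dvd 1 \<or> b dvd 1"
    using nz by (simp add: is_unit_iff_degree)
qed

lemma of_real_of_rat: "of_real (of_rat q) = (of_rat q :: 'a :: {real_field, field_char_0})"
  by (cases q) (simp add: of_rat_rat)

text \<open>If \<open>z\<close> is quadratic, the imaginary part of its equation, divided by
  \<open>Im z\<close>, yields the trace, and the real part then yields the norm. Conversely
  \<open>x^2 - t x + m\<close> has root \<open>z\<close> and equals
  \<open>(x - Re z)^2 + (Im z)^2\<close>, so it has no rational root.\<close>

lemma quadratic_point_iff:
  assumes "Im z \<noteq> 0"
  shows "quadratic_point z \<longleftrightarrow> 2 * Re z \<in> \<rat> \<and> (Re z)\<^sup>2 + (Im z)\<^sup>2 \<in> \<rat>"
proof
  assume "quadratic_point z"
  then obtain q :: "rat poly" where q: "degree q = 2" "poly (map_poly of_rat q) z = 0"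
    by (auto simp: quadratic_point_def)
  define q0 q1 q2 where "q0 = coeff q 0" and "q1 = coeff q 1" and "q2 = coeff q 2"
  have "q2 \<noteq> 0"
    using q(1) by (metis degree_0 leading_coeff_0_iff q2_def zero_neq_numeral)
  have "q = [:q0, q1, q2:]"
    unfolding poly_eq_iff q0_def q1_def q2_def
    using q(1) by (auto simp: coeff_pCons coeff_eq_0 numeral_2_eq_2 split: nat.split)
  then have "of_rat q0 + z * (of_rat q1 + z * of_rat q2) = 0"
    using q(2) \<open>q2 \<noteq> 0\<close> by (simp add: map_poly_pCons)
  then have "of_real (of_rat q0) + z * (of_real (of_rat q1) + z * of_real (of_rat q2)) = 0"
    by (simp add: of_real_of_rat)
  then have re: "of_rat q0 + of_rat q1 * Re z + of_rat q2 * ((Re z)\<^sup>2 - (Im z)\<^sup>2) = 0"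
    and im: "Im z * (of_rat q1 + of_rat q2 * (2 * Re z)) = 0"
    by (simp_all add: complex_eq_iff algebra_simps power2_eq_square)
  have q2: "(of_rat q2 :: real) \<noteq> 0"
    using \<open>q2 \<noteq> 0\<close> by simp
  have im': "of_rat q1 = - of_rat q2 * (2 * Re z)"
    using im assms by (simp add: add_eq_0_iff)
  then have "2 * Re z = of_rat (- q1 / q2)"
    using q2 by (simp add: of_rat_divide of_rat_minus)
  moreover have "of_rat q0 = of_rat q2 * ((Re z)\<^sup>2 + (Im z)\<^sup>2)"
    using re im' by algebra
  then have "(Re z)\<^sup>2 + (Im z)\<^sup>2 = of_rat (q0 / q2)"
    using q2 by (simp add: of_rat_divide)
  ultimately show "2 * Re z \<in> \<rat> \<and> (Re z)\<^sup>2 + (Im z)\<^sup>2 \<in> \<rat>"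
    by (metis Rats_of_rat)
next
  assume "2 * Re z \<in> \<rat> \<and> (Re z)\<^sup>2 + (Im z)\<^sup>2 \<in> \<rat>"
  then obtain t m where t: "2 * Re z = of_rat t" and m: "(Re z)\<^sup>2 + (Im z)\<^sup>2 = of_rat m"
    by (auto elim!: Rats_cases)
  define q where "q = [:m, - t, 1:]"
  have deg: "degree q = 2"
    by (simp add: q_def)
  have "poly (map_poly of_rat q) z = of_real (of_rat m) + z * (- of_real (of_rat t) + z)"
    by (simp add: q_def map_poly_pCons of_rat_minus of_real_of_rat)
  also have "\<dots> = 0"
    unfolding t[symmetric] m[symmetric] by (simp add: complex_eq_iff power2_eq_square algebra_simps)
  finally have root: "poly (map_poly of_rat q) z = 0" .
  have "poly q x \<noteq> 0" for x
  proof
    assume "poly q x = 0"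
    then have "of_rat (m + x * (x - t)) = (0::real)"
      by (simp add: q_def algebra_simps)
    then have "of_rat m + of_rat x * (of_rat x - of_rat t) = (0::real)"
      by (simp add: of_rat_add of_rat_mult of_rat_diff)
    then have "(of_rat x - Re z)\<^sup>2 + (Im z)\<^sup>2 = 0"
      unfolding t[symmetric] m[symmetric] by algebra
    then show False
      using assms by (simp add: sum_power2_eq_zero_iff)
  qed
  then have "irreducible q"
    using deg by (intro degree_2_irreducible_if_no_roots)
  then show "quadratic_point z"
    using assms deg root by (auto simp: quadratic_point_def)
qed

text \<open>Cramer's rule expresses trace and norm of \<open>z\<close> as rational functions of the
  entries of \<open>n\<close>; the determinant is nonzero because the kernel is trivial.\<close>

lemma rational_plane_fiber:
  assumes "n \<noteq> 0" "rational_vec n" "Im z > 0" "\<forall>a b. n \<bullet> root_cubic z a b = 0"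
  shows "quadratic_point z"
proof -
  define t m where "t = 2 * Re z" and "m = (Re z)\<^sup>2 + (Im z)\<^sup>2"
  have eq: "n$1 = t * n$2 - m * n$3" "n$2 = t * n$3 - m * n$4"
    using assms(4) by (simp_all add: fiber_in_plane_iff t_def m_def)
  have tm: "t\<^sup>2 < 4 * m"
    using trace_norm_disc[OF assms(3)] by (simp add: t_def m_def)
  define \<Delta> where "\<Delta> = n$3 * n$3 - n$2 * n$4"
  have kernel: "d = 0 \<and> e = 0" if "d * n$2 = e * n$3" "d * n$3 = e * n$4" for d e
    using fiber_system_kernel_trivial[OF eq tm that] \<open>n \<noteq> 0\<close> by (auto simp: vec4_eq_iff)
  have "\<Delta> \<noteq> 0"
  proof
    assume "\<Delta> = 0"
    \<comment> \<open>If \<open>\<Delta>\<close> vanishes, both \<open>(n$3, n$2)\<close> and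
      \<open>(n$4, n$3)\<close> solve the homogeneous system. Hence these entries are zero, and then
      \<open>(1, 0)\<close> is a solution too.\<close>
    then have "n$3 = 0 \<and> n$2 = 0" "n$4 = 0 \<and> n$3 = 0"
      by (intro kernel; simp add: \<Delta>_def mult.commute)+
    then show False
      using kernel[of 1 0] by simp
  qed
  moreover have "\<Delta> * t = n$2 * n$3 - n$1 * n$4" "\<Delta> * m = n$2 * n$2 - n$1 * n$3"
    unfolding \<Delta>_def using eq by algebra+
  ultimately have "t = (n$2 * n$3 - n$1 * n$4) / \<Delta>" "m = (n$2 * n$2 - n$1 * n$3) / \<Delta>"
    by (simp_all add: eq_divide_eq mult.commute)
  moreover have "n$i \<in> \<rat>" for i
    using assms(2) by (simp add: rational_vec_def)
  ultimately have "t \<in> \<rat>" "m \<in> \<rat>"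
    by (simp_all add: \<Delta>_def)
  then show ?thesis
    using assms(3) by (simp add: quadratic_point_iff t_def m_def)
qed

text \<open>The cubic is \<open>(c x + d y) (x^2 - t x y + m y^2)\<close> with rational
  \<open>t\<close> and \<open>m\<close>; its first two coefficients \<open>c\<close> and
  \<open>d - t c\<close> are rational, hence so is \<open>d\<close>.\<close>

lemma rational_cubic_with_quadratic_root:
  assumes "quadratic_point z" "Im z > 0" "f \<noteq> 0" "rational_vec f" "proj_class f \<in> root_fiber z"
  shows "has_rational_linear_factor f"
proof -
  obtain a b where ab: "a \<noteq> 0 \<or> b \<noteq> 0" "proj_class f = proj_class (root_cubic z a b)"
    using assms(2,5) by (auto simp: root_fiber_eq)
  then obtain r where r: "r \<noteq> 0" "root_cubic z a b = r *\<^sub>R f"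
    using proj_class_eq_iff[OF assms(3)] root_cubic_eq_0_iff by auto
  then have "f = inverse r *\<^sub>R root_cubic z a b" by simp
  then obtain c d where f: "f = root_cubic z c d"
    unfolding root_cubic_scale by blast
  obtain t m where t: "2 * Re z = of_rat t" and m: "(Re z)\<^sup>2 + (Im z)\<^sup>2 = of_rat m"
    using assms(1,2) by (auto simp: quadratic_point_iff elim!: Rats_cases)
  have "f$1 \<in> \<rat>" "f$2 \<in> \<rat>"
    using assms(4) by (auto simp: rational_vec_def)
  then have "c \<in> \<rat>" "d - of_rat t * c \<in> \<rat>"
    by (simp_all add: f t)
  then obtain c' d' where c: "c = of_rat c'" and d': "d - of_rat t * c = of_rat d'"
    by (auto elim!: Rats_cases)
  then have d: "d = of_rat (d' + t * c')"
    by (simp add: of_rat_add of_rat_mult algebra_simps)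
  define e where "e = d' + t * c'"
  have "(c', e) \<noteq> (0, 0)"
    using assms(3) by (auto simp: f c d e_def root_cubic_eq_0_iff)
  moreover have "cubic_eval f x y = (of_rat c' * x + of_rat e * y) *
      (of_rat 1 * x^2 + of_rat (- t) * x * y + of_rat m * y^2)" for x y
  proof -
    have "of_rat t = complex_of_real (2 * Re z)" "of_rat m = complex_of_real ((Re z)\<^sup>2 + (Im z)\<^sup>2)"
      by (simp_all only: t m of_real_of_rat)
    then have tz: "of_rat t = z + cnj z" and mz: "of_rat m = z * cnj z"
      by (simp_all only: complex_add_cnj complex_mult_cnj)
    show ?thesis
      unfolding f cubic_eval_root_cubic c d e_def[symmetric] of_rat_minus tz mz
      by (simp add: algebra_simps power2_eq_square of_real_of_rat)
  qed
  ultimately show ?thesis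
    unfolding has_rational_linear_factor_def by blast
qed

lemma root_fiber_nonempty: "Im z > 0 \<Longrightarrow> root_fiber z \<noteq> {}"
  by (auto simp: root_fiber_eq intro: exI[of _ 1])

lemma quadratic_point_singular:
  assumes "quadratic_point z" "Im z > 0"
  shows "\<exists>P. rational_plane P \<and> singular_locus P \<noteq> {} \<and> singular_locus P = root_fiber z"
proof -
  define t m where "t = 2 * Re z" and "m = (Re z)\<^sup>2 + (Im z)\<^sup>2"
  \<comment> \<open>Fix \<open>n$3 = 0\<close> and \<open>n$4 = 1\<close>, then solve the two plane
    equations for \<open>n$2\<close> and \<open>n$1\<close>.\<close>
  define n :: "real^4" where "n = vector [- t * m, - m, 0, 1]"
  have n: "n$1 = - t * m" "n$2 = - m" "n$3 = 0" "n$4 = 1"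
    by (simp_all add: n_def vector_def)
  have "n \<noteq> 0"
    by (simp add: vec4_eq_iff n)
  have "t \<in> \<rat>" "m \<in> \<rat>"
    using assms by (simp_all add: quadratic_point_iff t_def m_def)
  then have "rational_vec n"
    by (simp add: rational_vec_def forall_4 n)
  with \<open>n \<noteq> 0\<close> have "rational_plane (plane_normal n)"
    by (auto simp: rational_plane_def)
  moreover have "\<forall>a b. n \<bullet> root_cubic z a b = 0"
    unfolding fiber_in_plane_iff n t_def m_def by (simp add: algebra_simps)
  then have "singular_locus (plane_normal n) = root_fiber z"
    using assms \<open>n \<noteq> 0\<close> by (intro singular_locus_eq_fiber)
  ultimately show ?thesis
    using root_fiber_nonempty[OF assms(2)] by auto
qed

theorem corollary4p30:
  "(\<forall>P. proj_plane P \<longrightarrow>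
      singular_locus P = {} \<or>
      (\<exists>L. proj_line L \<and> L \<subseteq> neg_disc_cubics \<inter> P \<and> singular_locus P = L \<and>
           (\<exists>z. \<forall>p\<in>L. complex_root p = z)))
   \<and> (\<forall>P. rational_plane P \<and> singular_locus P \<noteq> {} \<longrightarrow>
      (\<exists>z. quadratic_point z \<and> Im z > 0 \<and> singular_locus P = root_fiber z) \<and>
      (\<forall>f. f \<noteq> 0 \<and> rational_vec f \<and> proj_class f \<in> singular_locus P \<longrightarrow>
           has_rational_linear_factor f))
   \<and> (\<forall>z. quadratic_point z \<and> Im z > 0 \<longrightarrow>
      (\<exists>P. rational_plane P \<and> singular_locus P \<noteq> {} \<and> singular_locus P = root_fiber z))"
proof (intro conjI allI impI)
  fix P assume "proj_plane P"
  then obtain n where n: "n \<noteq> 0" "P = plane_normal n"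
    by (auto simp: proj_plane_def)
  show "singular_locus P = {} \<or>
      (\<exists>L. proj_line L \<and> L \<subseteq> neg_disc_cubics \<inter> P \<and> singular_locus P = L \<and>
           (\<exists>z. \<forall>p\<in>L. complex_root p = z))"
  proof (rule disjCI)
    assume "\<not> (\<exists>L. proj_line L \<and> L \<subseteq> neg_disc_cubics \<inter> P \<and> singular_locus P = L \<and>
           (\<exists>z. \<forall>p\<in>L. complex_root p = z))"
    moreover have "singular_locus P \<subseteq> neg_disc_cubics \<inter> P"
      by (auto simp: singular_locus_def)
    moreover have "proj_line (singular_locus P)" "\<exists>z. \<forall>p\<in>singular_locus P. complex_root p = z"
      if "singular_locus P \<noteq> {}"
    proof -
      from that n(2) have "singular_locus (plane_normal n) \<noteq> {}" by simp
      with n(1) obtain z where "Im z > 0" "singular_locus (plane_normal n) = root_fiber z"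
        by (rule singular_locus_cases)
      with n(2) show "proj_line (singular_locus P)" "\<exists>z. \<forall>p\<in>singular_locus P. complex_root p = z"
        using root_fiber_proj_line by (auto simp: root_fiber_def)
    qed
    ultimately show "singular_locus P = {}" by blast
  qed
next
  fix P assume P: "rational_plane P \<and> singular_locus P \<noteq> {}"
  then obtain n where n: "n \<noteq> 0" "rational_vec n" "P = plane_normal n"
    by (auto simp: rational_plane_def)
  have "singular_locus (plane_normal n) \<noteq> {}"
    using P n(3) by simp
  with n(1) obtain z where z: "Im z > 0" "\<forall>a b. n \<bullet> root_cubic z a b = 0"
    "singular_locus (plane_normal n) = root_fiber z"
    by (rule singular_locus_cases)
  note z = z[folded n(3)]
  have q: "quadratic_point z"
    using rational_plane_fiber n z by blast
  show "\<exists>z. quadratic_point z \<and> Im z > 0 \<and> singular_locus P = root_fiber z"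
    using q z by blast
  show "has_rational_linear_factor f"
    if "f \<noteq> 0 \<and> rational_vec f \<and> proj_class f \<in> singular_locus P" for f
    using that q z rational_cubic_with_quadratic_root by auto
next
  fix z assume "quadratic_point z \<and> Im z > 0"
  then show "\<exists>P. rational_plane P \<and> singular_locus P \<noteq> {} \<and> singular_locus P = root_fiber z"
    using quadratic_point_singular by blast
qed

end
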